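(* Let $\Delta$ be a $d$-dimensional simplicial complex. (1) If $\Delta$ is skeleton-E-chordal, then either $\Delta$ is a vertex neighborhood (i.e. $\Delta=N(v,\Delta)$ for some vertex $v$), or it splits as $\Delta=\Delta_1\cup\Delta_2$, where $\Delta_1$ and $\Delta_2$ are proper skeleton-E-chordal subcomplexes of $\Delta$, and $\Delta_1\cap\Delta_2$ is a complex whose $1$-skeleton is a clique. (2) Suppose $\Delta$ splits as $\Delta=\Delta_1\cup\Delta_2$, where each $\Delta_i$ is a proper skeleton-clique-chordal subcomplex of $\Delta$, and $\Delta_1\cap\Delta_2$ is a complex whose $1$-skeleton is a clique. Then $\Delta$ is skeleton-clique-chordal.
   Context: Simplicial complexes are finite and not necessarily pure. A "clique" as a $1$-skeleton means a complete graph. The neighborhood $N(v,\Delta)$ of a vertex $v$ is the complex obtained from $\Delta$ by deleting all vertices that are neither $v$ nor connected by an edge to $v$ (i.e. the induced subcomplex on $v$ and its neighbors). A vertex labeling of a complex with $n$ vertices is a bijection of its vertices with $[n]$; $\max f$ is the largest label in $f$; the size of a face is its number of vertices. A complex $\Gamma$ is skeleton-E-chordal if it has a vertex labeling such that for every two faces $f\neq g$ of $\Gamma$ with the same size and the same maximum, every subset $h\subseteq f\cup g$ with $|h|=|f|$ is a face of $\Gamma$. $\Gamma$ is skeleton-clique-chordal if it has a vertex labeling such that for every two faces $f\ne g$ of $\Gamma$ with the same size $\ge 2$ and the same maximum, every $2$-element subset of $f\cup g$ is a face of $\Gamma$. *)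

theory Defs
  imports Main "HOL-Library.Ramsey"
begin

(* The empty set is always a face, so the intersection of two complexes is again a complex,
   and the smallest complex is {{}}, of dimension -1. *)
definition simplicial_complex :: "'a set set \<Rightarrow> bool" where
  "simplicial_complex \<Delta> \<longleftrightarrow>
     finite \<Delta> \<and> (\<forall>f\<in>\<Delta>. finite f) \<and> {} \<in> \<Delta> \<and> (\<forall>f\<in>\<Delta>. \<forall>g. g \<subseteq> f \<longrightarrow> g \<in> \<Delta>)"

definition vertices :: "'a set set \<Rightarrow> 'a set" where
  "vertices \<Delta> = \<Union>\<Delta>"

definition dimension :: "'a set set \<Rightarrow> int" where
  "dimension \<Delta> = int (Max (card ` \<Delta>)) - 1"

definition proper_subcomplex :: "'a set set \<Rightarrow> 'a set set \<Rightarrow> bool" where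
  "proper_subcomplex \<Gamma> \<Delta> \<longleftrightarrow> simplicial_complex \<Gamma> \<and> \<Gamma> \<subset> \<Delta>"

definition induced_subcomplex :: "'a set \<Rightarrow> 'a set set \<Rightarrow> 'a set set" where
  "induced_subcomplex W \<Delta> = {f \<in> \<Delta>. f \<subseteq> W}"

definition neighborhood :: "'a \<Rightarrow> 'a set set \<Rightarrow> 'a set set" where
  "neighborhood v \<Delta> = induced_subcomplex {w \<in> vertices \<Delta>. w = v \<or> {v, w} \<in> \<Delta>} \<Delta>"

definition skeleton :: "nat \<Rightarrow> 'a set set \<Rightarrow> 'a set set" where
  "skeleton k \<Delta> = {f \<in> \<Delta>. card f \<le> k + 1}"

(* The graph on no vertices counts as complete: complexes with disjoint vertex sets
   meet in {{}}, and this intersection is allowed. *)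
definition clique_skeleton :: "'a set set \<Rightarrow> bool" where
  "clique_skeleton \<Gamma> \<longleftrightarrow> clique (vertices \<Gamma>) (skeleton 1 \<Gamma>)"

definition vertex_labeling :: "('a \<Rightarrow> nat) \<Rightarrow> 'a set set \<Rightarrow> bool" where
  "vertex_labeling l \<Delta> \<longleftrightarrow> bij_betw l (vertices \<Delta>) {1..card (vertices \<Delta>)}"

(* Max (l ` f) is unspecified for f = {}, but two distinct faces of the same size are nonempty. *)
definition skeleton_E_chordal :: "'a set set \<Rightarrow> bool" where
  "skeleton_E_chordal \<Gamma> \<longleftrightarrow>
     (\<exists>l. vertex_labeling l \<Gamma> \<and>
        (\<forall>f\<in>\<Gamma>. \<forall>g\<in>\<Gamma>. f \<noteq> g \<and> card f = card g \<and> Max (l ` f) = Max (l ` g) \<longrightarrow>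
           (\<forall>h. h \<subseteq> f \<union> g \<and> card h = card f \<longrightarrow> h \<in> \<Gamma>)))"

definition skeleton_clique_chordal :: "'a set set \<Rightarrow> bool" where
  "skeleton_clique_chordal \<Gamma> \<longleftrightarrow>
     (\<exists>l. vertex_labeling l \<Gamma> \<and>
        (\<forall>f\<in>\<Gamma>. \<forall>g\<in>\<Gamma>. f \<noteq> g \<and> card f = card g \<and> card f \<ge> 2 \<and> Max (l ` f) = Max (l ` g) \<longrightarrow>
           (\<forall>h. h \<subseteq> f \<union> g \<and> card h = 2 \<longrightarrow> h \<in> \<Gamma>)))"

end

theory Submission
  imports Defs
begin

text \<open>
  (1) Let \<open>n\<close> be the vertex with the largest label. Two edges through \<open>n\<close> have the same size and the
  same maximum, so the neighbours of \<open>n\<close> span a clique. Unless \<open>\<Delta> = N(n, \<Delta>)\<close>, split \<open>\<Delta>\<close> into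
  \<open>N(n, \<Delta>)\<close> and the deletion of \<open>n\<close>; skeleton-E-chordality passes to induced subcomplexes.

  (2) Skeleton-clique-chordality depends only on the 1-skeleton: it says that the labeling is a
  perfect elimination ordering of that graph. If a graph has such an ordering and \<open>K\<close> is a clique
  that is not the whole vertex set, then some vertex outside \<open>K\<close> has a clique as neighbourhood.
  Hence the vertices of \<open>\<Delta>2\<close> outside \<open>\<Delta>1\<close> can be appended, one at a time, to an elimination
  ordering of \<open>\<Delta>1\<close>.
\<close>

section \<open>Induced subcomplexes\<close>

lemma finite_vertices: "simplicial_complex \<Delta> \<Longrightarrow> finite (vertices \<Delta>)"
  by (auto simp: simplicial_complex_def vertices_def)

lemma face_subset: "simplicial_complex \<Delta> \<Longrightarrow> f \<in> \<Delta> \<Longrightarrow> g \<subseteq> f \<Longrightarrow> g \<in> \<Delta>"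
  by (auto simp: simplicial_complex_def)

lemma finite_face: "simplicial_complex \<Delta> \<Longrightarrow> f \<in> \<Delta> \<Longrightarrow> finite f"
  by (auto simp: simplicial_complex_def)

lemma face_subset_vertices: "f \<in> \<Delta> \<Longrightarrow> f \<subseteq> vertices \<Delta>"
  by (auto simp: vertices_def)

lemma vertex_iff_singleton_face:
  assumes "simplicial_complex \<Delta>"
  shows "v \<in> vertices \<Delta> \<longleftrightarrow> {v} \<in> \<Delta>"
  using face_subset[OF assms, of _ "{v}"] by (auto simp: vertices_def)

lemma simplicial_complex_induced:
  "simplicial_complex \<Delta> \<Longrightarrow> simplicial_complex (induced_subcomplex W \<Delta>)"
  unfolding simplicial_complex_def induced_subcomplex_def by auto

lemma simplicial_complex_Int:
  "simplicial_complex \<Delta>1 \<Longrightarrow> simplicial_complex \<Delta>2 \<Longrightarrow> simplicial_complex (\<Delta>1 \<inter> \<Delta>2)"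
  unfolding simplicial_complex_def by auto

lemma vertices_Int:
  assumes "simplicial_complex \<Delta>1" "simplicial_complex \<Delta>2"
  shows "vertices (\<Delta>1 \<inter> \<Delta>2) = vertices \<Delta>1 \<inter> vertices \<Delta>2"
  using assms simplicial_complex_Int[OF assms] by (auto simp: vertex_iff_singleton_face)

text \<open>\<open>clique\<close> tests only two-element sets, and \<open>skeleton 1\<close> keeps
  every face of that size.\<close>

lemma clique_skeleton_iff: "clique_skeleton \<Gamma> \<longleftrightarrow> clique (vertices \<Gamma>) \<Gamma>"
  by (auto simp: clique_skeleton_def skeleton_def clique_def card_insert_if)

section \<open>Restricting labelings and skeleton-E-chordality\<close>

text \<open>A labeling restricted to fewer vertices has gaps in its range. Replacing each label by
  its rank within \<open>W\<close> closes the gaps and keeps the order.\<close>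

lemma ex_labeling_of_inj:
  fixes l :: "'a \<Rightarrow> nat"
  assumes "finite W" "inj_on l W"
  shows "\<exists>r. bij_betw r W {1..card W} \<and> (\<forall>u\<in>W. \<forall>v\<in>W. r u \<le> r v \<longleftrightarrow> l u \<le> l v)"
proof -
  \<comment> \<open>The rank counts \<open>v\<close> itself, so ranks start at 1.\<close>
  define r where "r v = card {u \<in> W. l u \<le> l v}" for v
  have iso: "r u \<le> r v \<longleftrightarrow> l u \<le> l v" if "u \<in> W" "v \<in> W" for u v
  proof
    assume "l u \<le> l v"
    then show "r u \<le> r v"
      unfolding r_def using assms(1) by (intro card_mono) auto
  next
    assume le: "r u \<le> r v"
    show "l u \<le> l v"
    proof (rule ccontr)
      assume "\<not> l u \<le> l v"
      then have "{x \<in> W. l x \<le> l v} \<subset> {x \<in> W. l x \<le> l u}"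
        using that by auto
      then have "r v < r u"
        unfolding r_def using assms(1) by (intro psubset_card_mono) auto
      with le show False by simp
    qed
  qed
  have inj: "inj_on r W"
    using iso assms(2) by (metis inj_on_def order_antisym order_refl)
  have "r ` W \<subseteq> {1..card W}"
  proof
    fix k assume "k \<in> r ` W"
    then obtain v where v: "v \<in> W" "k = r v" by auto
    have "card {v} \<le> r v"
      unfolding r_def using assms(1) v by (intro card_mono) auto
    moreover have "r v \<le> card W"
      unfolding r_def using assms(1) by (intro card_mono) auto
    ultimately show "k \<in> {1..card W}" using v by simp
  qed
  then have "r ` W = {1..card W}"
    using card_image[OF inj] by (intro card_subset_eq) auto
  with inj iso show ?thesis by (auto simp: bij_betw_def)
qed

text \<open>Carries equality of maxima from the rank labeling back to the original one. Only one
  inequality is proved; exchanging \<open>f\<close> and \<open>g\<close> gives the other.\<close>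

lemma Max_image_le_of_iso:
  fixes r l :: "'a \<Rightarrow> nat"
  assumes iso: "\<And>u v. u \<in> W \<Longrightarrow> v \<in> W \<Longrightarrow> r u \<le> r v \<Longrightarrow> l u \<le> l v"
    and "f \<subseteq> W" "g \<subseteq> W" "finite f" "finite g" "f \<noteq> {}" "g \<noteq> {}"
    and eq: "Max (r ` f) = Max (r ` g)"
  shows "Max (l ` f) \<le> Max (l ` g)"
proof -
  have "Max (r ` g) \<in> r ` g" using assms by (intro Max_in) auto
  then obtain q where q: "q \<in> g" "Max (r ` g) = r q" by auto
  have "l u \<le> Max (l ` g)" if "u \<in> f" for u
  proof -
    have "r u \<le> Max (r ` f)" using that \<open>finite f\<close> by simp
    then have "r u \<le> r q" using eq q by simp
    then have "l u \<le> l q" using iso that q assms by blast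
    also have "\<dots> \<le> Max (l ` g)" using assms q by simp
    finally show ?thesis .
  qed
  then show ?thesis using assms by simp
qed

text \<open>Only the order of the labels matters, so ranks serve as the new labeling. The required
  \<open>h\<close> is a face of \<open>\<Delta>\<close> and lies inside \<open>f \<union> g\<close>,
  hence inside \<open>W\<close>.\<close>

lemma skeleton_E_chordal_induced:
  assumes sc: "simplicial_complex \<Delta>" and chordal: "skeleton_E_chordal \<Delta>"
  shows "skeleton_E_chordal (induced_subcomplex W \<Delta>)"
proof -
  let ?\<Gamma> = "induced_subcomplex W \<Delta>"
  let ?V = "vertices ?\<Gamma>"
  have sub: "?\<Gamma> \<subseteq> \<Delta>" by (auto simp: induced_subcomplex_def)
  obtain l where l: "vertex_labeling l \<Delta>"
    and E: "\<And>f g h. f \<in> \<Delta> \<Longrightarrow> g \<in> \<Delta> \<Longrightarrow> f \<noteq> g \<Longrightarrow> card f = card g \<Longrightarrow>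
      Max (l ` f) = Max (l ` g) \<Longrightarrow> h \<subseteq> f \<union> g \<Longrightarrow> card h = card f \<Longrightarrow> h \<in> \<Delta>"
    using chordal unfolding skeleton_E_chordal_def by metis
  have "inj_on l (vertices \<Delta>)" using l by (simp add: vertex_labeling_def bij_betw_def)
  moreover have "?V \<subseteq> vertices \<Delta>" using sub by (auto simp: vertices_def)
  ultimately have "inj_on l ?V" by (rule inj_on_subset)
  moreover have "finite ?V" using sc simplicial_complex_induced finite_vertices by blast
  ultimately obtain r where r: "bij_betw r ?V {1..card ?V}"
    and iso: "\<forall>u\<in>?V. \<forall>v\<in>?V. r u \<le> r v \<longleftrightarrow> l u \<le> l v"
    using ex_labeling_of_inj[of ?V l] by auto
  have "h \<in> ?\<Gamma>"
    if "f \<in> ?\<Gamma>" "g \<in> ?\<Gamma>" "f \<noteq> g" "card f = card g" "Max (r ` f) = Max (r ` g)"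
      "h \<subseteq> f \<union> g" "card h = card f" for f g h
  proof -
    have fin: "finite f" "finite g" using that sub finite_face[OF sc] by auto
    \<comment> \<open>If one were empty, equal size would make both empty, contradicting
      \<open>f \<noteq> g\<close>. So both maxima are genuine.\<close>
    have ne: "f \<noteq> {}" "g \<noteq> {}" using that fin by auto
    have V: "f \<subseteq> ?V" "g \<subseteq> ?V" using that face_subset_vertices by auto
    have iso': "l u \<le> l v" if "u \<in> ?V" "v \<in> ?V" "r u \<le> r v" for u v
      using iso that by blast
    have "Max (l ` f) = Max (l ` g)"
      using Max_image_le_of_iso[OF iso' V fin ne that(5)]
        Max_image_le_of_iso[OF iso' V(2,1) fin(2,1) ne(2,1) that(5)[symmetric]]
      by (rule order_antisym)
    then have "h \<in> \<Delta>" using E[of f g h] that sub by auto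
    moreover have "h \<subseteq> W" using that by (auto simp: induced_subcomplex_def)
    ultimately show ?thesis by (simp add: induced_subcomplex_def)
  qed
  then show ?thesis
    unfolding skeleton_E_chordal_def vertex_labeling_def using r by blast
qed

section \<open>Splitting at the vertex of largest label\<close>

lemma skeleton_E_chordal_splits:
  assumes sc: "simplicial_complex \<Delta>" and chordal: "skeleton_E_chordal \<Delta>"
    and nonempty: "vertices \<Delta> \<noteq> {}"
  shows "(\<exists>v\<in>vertices \<Delta>. \<Delta> = neighborhood v \<Delta>) \<or>
    (\<exists>\<Delta>1 \<Delta>2. \<Delta> = \<Delta>1 \<union> \<Delta>2 \<and>
       proper_subcomplex \<Delta>1 \<Delta> \<and> skeleton_E_chordal \<Delta>1 \<and>
       proper_subcomplex \<Delta>2 \<Delta> \<and> skeleton_E_chordal \<Delta>2 \<and>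
       simplicial_complex (\<Delta>1 \<inter> \<Delta>2) \<and> clique_skeleton (\<Delta>1 \<inter> \<Delta>2))"
proof (rule disjCI)
  assume no_split: "\<not> (\<exists>\<Delta>1 \<Delta>2. \<Delta> = \<Delta>1 \<union> \<Delta>2 \<and>
       proper_subcomplex \<Delta>1 \<Delta> \<and> skeleton_E_chordal \<Delta>1 \<and>
       proper_subcomplex \<Delta>2 \<Delta> \<and> skeleton_E_chordal \<Delta>2 \<and>
       simplicial_complex (\<Delta>1 \<inter> \<Delta>2) \<and> clique_skeleton (\<Delta>1 \<inter> \<Delta>2))" (is "\<not> ?split")
  obtain l where l: "vertex_labeling l \<Delta>"
    and E: "\<And>f g h. f \<in> \<Delta> \<Longrightarrow> g \<in> \<Delta> \<Longrightarrow> f \<noteq> g \<Longrightarrow> card f = card g \<Longrightarrow>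
      Max (l ` f) = Max (l ` g) \<Longrightarrow> h \<subseteq> f \<union> g \<Longrightarrow> card h = card f \<Longrightarrow> h \<in> \<Delta>"
    using chordal unfolding skeleton_E_chordal_def by metis
  obtain n where n: "n \<in> vertices \<Delta>" and n_max: "\<And>u. u \<in> vertices \<Delta> \<Longrightarrow> l u \<le> l n"
    using Max_in[of "l ` vertices \<Delta>"] Max_ge[of "l ` vertices \<Delta>"]
      nonempty finite_vertices[OF sc] by fastforce
  let ?A = "neighborhood n \<Delta>" and ?B = "induced_subcomplex (- {n}) \<Delta>"
  have sc_A: "simplicial_complex ?A" and sc_B: "simplicial_complex ?B"
    using sc by (simp_all add: neighborhood_def simplicial_complex_induced)
  have "\<Delta> = ?A"
  proof (rule ccontr)
    assume "\<Delta> \<noteq> ?A"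
    then have "?A \<subset> \<Delta>" by (auto simp: neighborhood_def induced_subcomplex_def)
    then have "proper_subcomplex ?A \<Delta>" using sc_A by (simp add: proper_subcomplex_def)
    moreover have "{n} \<in> \<Delta>" using n vertex_iff_singleton_face[OF sc] by simp
    then have "?B \<subset> \<Delta>" by (auto simp: induced_subcomplex_def)
    then have "proper_subcomplex ?B \<Delta>" using sc_B by (simp add: proper_subcomplex_def)
    moreover have "skeleton_E_chordal ?A" "skeleton_E_chordal ?B"
      using skeleton_E_chordal_induced[OF sc chordal] by (simp_all add: neighborhood_def)
    \<comment> \<open>Faces through \<open>n\<close> lie in \<open>?A\<close>, all others in
      \<open>?B\<close>; hence the two pieces cover \<open>\<Delta>\<close>.\<close>
    moreover have "f \<in> ?A" if f: "f \<in> \<Delta>" "n \<in> f" for f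
    proof -
      have "{n, w} \<in> \<Delta>" if "w \<in> f" for w
        using f that face_subset[OF sc f(1), of "{n, w}"] by simp
      then show ?thesis
        using f face_subset_vertices[OF f(1)]
        by (auto simp: neighborhood_def induced_subcomplex_def)
    qed
    then have "\<Delta> \<subseteq> ?A \<union> ?B" by (auto simp: induced_subcomplex_def)
    then have "\<Delta> = ?A \<union> ?B"
      using \<open>?A \<subset> \<Delta>\<close> \<open>?B \<subset> \<Delta>\<close> by blast
    moreover have "simplicial_complex (?A \<inter> ?B)" using sc_A sc_B by (rule simplicial_complex_Int)
    moreover have "clique_skeleton (?A \<inter> ?B)"
      unfolding clique_skeleton_iff clique_def
    proof (intro ballI impI)
      fix a b assume a: "a \<in> vertices (?A \<inter> ?B)" and b: "b \<in> vertices (?A \<inter> ?B)" and ab: "a \<noteq> b"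
      have edge: "{c, n} \<in> \<Delta> \<and> c \<noteq> n \<and> c \<in> vertices \<Delta>" if "c \<in> vertices (?A \<inter> ?B)" for c
        using that by (auto simp: vertices_def neighborhood_def induced_subcomplex_def insert_commute)
      have max: "Max (l ` {c, n}) = l n" if "c \<in> vertices \<Delta>" for c
        using n_max[OF that] by simp
      \<comment> \<open>Both edges have maximum \<open>l n\<close>, so E-chordality applies to them
        with \<open>h = {a, b}\<close>.\<close>
      have "{a, n} \<noteq> {b, n}" using ab by (auto simp: doubleton_eq_iff)
      then have "{a, b} \<in> \<Delta>"
        using E[of "{a, n}" "{b, n}" "{a, b}"] edge[OF a] edge[OF b] max ab by simp
      then show "{a, b} \<in> ?A \<inter> ?B"
        using edge[OF a] edge[OF b]
        by (auto simp: neighborhood_def induced_subcomplex_def insert_commute)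
    qed
    ultimately have ?split by blast
    with no_split show False by contradiction
  qed
  with n show "\<exists>v\<in>vertices \<Delta>. \<Delta> = neighborhood v \<Delta>" by blast
qed

section \<open>Perfect elimination\<close>

text \<open>A perfect elimination ordering read backwards: the vertex inserted last is the first to
  be eliminated. \<open>E\<close> may be a whole complex, since only its two-element members are
  consulted; it stays fixed while \<open>V\<close> grows, so the graph meant is the one induced on
  \<open>V\<close>.\<close>

inductive perfectly_eliminable :: "'a set set \<Rightarrow> 'a set \<Rightarrow> bool" for E where
  empty: "perfectly_eliminable E {}"
| insert: "perfectly_eliminable E V \<Longrightarrow> v \<notin> V \<Longrightarrow> clique {a \<in> V. {v, a} \<in> E} E \<Longrightarrow>
    perfectly_eliminable E (insert v V)"

text \<open>The same insertion order works with the vertices outside \<open>U\<close> skipped,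
  because subsets of cliques are cliques.\<close>

lemma perfectly_eliminable_subset:
  "perfectly_eliminable E V \<Longrightarrow> U \<subseteq> V \<Longrightarrow> perfectly_eliminable E U"
proof (induction arbitrary: U rule: perfectly_eliminable.induct)
  case empty
  then show ?case by (simp add: perfectly_eliminable.empty)
next
  case (insert V v)
  show ?case
  proof (cases "v \<in> U")
    case True
    have "perfectly_eliminable E (U - {v})" using insert.prems by (intro insert.IH) auto
    moreover have "clique {a \<in> U - {v}. {v, a} \<in> E} E"
      using insert.hyps(3) insert.prems by (auto simp: clique_def)
    ultimately show ?thesis
      using perfectly_eliminable.insert[of E "U - {v}" v] insert_Diff[OF True] by simp
  next
    case False
    then show ?thesis using insert.prems by (intro insert.IH) auto
  qed
qed

text \<open>A form of Dirac's lemma on simplicial vertices of chordal graphs. The last inserted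
  vertex \<open>n\<close> works unless it lies in \<open>K\<close>; in that case a vertex not
  adjacent to \<open>n\<close> is sought, as such a vertex cannot belong to the clique
  \<open>K\<close>.\<close>

lemma ex_simplicial_vertex_outside_clique:
  "perfectly_eliminable E V \<Longrightarrow> clique K E \<Longrightarrow> K \<subset> V \<Longrightarrow>
    \<exists>w\<in>V - K. clique {a \<in> V - {w}. {w, a} \<in> E} E"
proof (induction arbitrary: K rule: perfectly_eliminable.induct)
  case empty
  then show ?case by simp
next
  case (insert V n)
  let ?N = "{a \<in> V. {n, a} \<in> E}"
  consider "n \<notin> K" | "n \<in> K" "?N = V" | "n \<in> K" "?N \<subset> V" by blast
  then show ?case
  proof cases
    case 1
    have "{a \<in> insert n V - {n}. {n, a} \<in> E} = ?N" using insert.hyps(2) by auto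
    with 1 insert.hyps(3) show ?thesis by (intro bexI[of _ n]) auto
  next
    case 2
    \<comment> \<open>Here all of \<open>insert n V\<close> is a clique, so any vertex outside
      \<open>K\<close> will do.\<close>
    have "{n, a} \<in> E \<and> {a, n} \<in> E" if "a \<in> V" for a
      using 2(2) that by (auto simp: insert_commute)
    then have "clique (insert n V) E"
      using insert.hyps(3) 2(2) by (auto simp: clique_def)
    with insert.prems(2) show ?thesis unfolding clique_def by blast
  next
    case 3
    \<comment> \<open>The induction hypothesis is used with the clique \<open>?N\<close> in place of
      \<open>K\<close>. The resulting \<open>w\<close> is not adjacent to \<open>n\<close>, so
      inserting \<open>n\<close> leaves its neighbourhood unchanged.\<close>
    then obtain w where w: "w \<in> V - ?N" "clique {a \<in> V - {w}. {w, a} \<in> E} E"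
      using insert.IH insert.hyps(3) by blast
    then have "{w, n} \<notin> E" by (auto simp: insert_commute)
    then have "{a \<in> insert n V - {w}. {w, a} \<in> E} = {a \<in> V - {w}. {w, a} \<in> E}" by auto
    moreover have "w \<notin> K"
    proof
      assume "w \<in> K"
      moreover have "w \<noteq> n" using w(1) insert.hyps(2) by auto
      ultimately have "{w, n} \<in> E" using 3(1) insert.prems(1) by (simp add: clique_def)
      with \<open>{w, n} \<notin> E\<close> show False by contradiction
    qed
    ultimately show ?thesis using w by (intro bexI[of _ w]) auto
  qed
qed

text \<open>Start from \<open>V1\<close> and add the rest of \<open>V2\<close> vertex by vertex. The
  order comes from repeatedly removing from \<open>V2\<close> a simplicial vertex outside the clique
  \<open>V1 \<inter> V2\<close>.\<close>

lemma perfectly_eliminable_glue: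
  assumes elim1: "perfectly_eliminable E V1" and elim2: "perfectly_eliminable E V2"
    and fin: "finite V2" and clique: "clique (V1 \<inter> V2) E"
    and no_cross: "\<And>u v. u \<in> V1 \<Longrightarrow> v \<in> V2 - V1 \<Longrightarrow> {v, u} \<in> E \<Longrightarrow> u \<in> V2"
  shows "perfectly_eliminable E (V1 \<union> V2)"
proof -
  have "perfectly_eliminable E (V1 \<union> W)" if "V1 \<inter> V2 \<subseteq> W" "W \<subseteq> V2" for W
    using finite_subset[OF that(2) fin] that
  proof (induction W rule: finite_psubset_induct)
    case (psubset W)
    show ?case
    proof (cases "W = V1 \<inter> V2")
      case True
      then show ?thesis using elim1 by (simp add: Un_absorb2)
    next
      case False
      with psubset.prems have "V1 \<inter> V2 \<subset> W" by blast
      then obtain w where w: "w \<in> W - V1 \<inter> V2" "clique {a \<in> W - {w}. {w, a} \<in> E} E"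
        using ex_simplicial_vertex_outside_clique clique
          perfectly_eliminable_subset[OF elim2 psubset.prems(2)] by blast
      have w': "w \<in> W" "w \<in> V2" "w \<notin> V1" using w psubset.prems by auto
      \<comment> \<open>By \<open>no_cross\<close>, a neighbour of \<open>w\<close> in
        \<open>V1\<close> lies in \<open>V1 \<inter> V2\<close>, hence in \<open>W\<close>. So
        \<open>V1\<close> contributes no new neighbours.\<close>
      have "{a \<in> V1 \<union> (W - {w}). {w, a} \<in> E} \<subseteq> {a \<in> W - {w}. {w, a} \<in> E}"
        using no_cross[of _ w] w' psubset.prems by blast
      then have "clique {a \<in> V1 \<union> (W - {w}). {w, a} \<in> E} E"
        using w(2) unfolding clique_def by blast
      moreover have "perfectly_eliminable E (V1 \<union> (W - {w}))"
        using psubset.IH[of "W - {w}"] psubset.prems w w' by blast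
      ultimately have "perfectly_eliminable E (insert w (V1 \<union> (W - {w})))"
        using w' by (intro perfectly_eliminable.insert) auto
      moreover have "insert w (V1 \<union> (W - {w})) = V1 \<union> W" using w' by auto
      ultimately show ?thesis by simp
    qed
  qed
  then show ?thesis by blast
qed

lemma perfectly_eliminable_cong:
  assumes "perfectly_eliminable E V" and "\<And>u v. u \<in> V \<Longrightarrow> v \<in> V \<Longrightarrow> {u, v} \<in> E \<longleftrightarrow> {u, v} \<in> E'"
  shows "perfectly_eliminable E' V"
  using assms
proof (induction rule: perfectly_eliminable.induct)
  case empty
  show ?case by (rule perfectly_eliminable.empty)
next
  case (insert V v)
  then have "clique {a \<in> V. {v, a} \<in> E'} E'" by (simp add: clique_def)
  with insert show ?case by (intro perfectly_eliminable.insert) auto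
qed

text \<open>Labels record the order of insertion, so the neighbours of \<open>m\<close> with smaller
  label are those already present when \<open>m\<close> was inserted.\<close>

lemma perfectly_eliminable_labeling:
  "perfectly_eliminable E V \<Longrightarrow> finite V \<and> (\<exists>l. bij_betw l V {1..card V} \<and>
    (\<forall>m\<in>V. clique {a \<in> V. l a < l m \<and> {m, a} \<in> E} E))"
proof (induction rule: perfectly_eliminable.induct)
  case empty
  then show ?case by (simp add: bij_betw_def)
next
  case (insert V v)
  then obtain l where l: "bij_betw l V {1..card V}"
    and elim: "\<And>m. m \<in> V \<Longrightarrow> clique {a \<in> V. l a < l m \<and> {m, a} \<in> E} E"
    and fin: "finite V" by blast
  define r where "r = l(v := Suc (card V))"
  have r_v: "r v = Suc (card V)" and r_V: "r a = l a" if "a \<in> V" for a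
    using that insert.hyps(2) by (auto simp: r_def)
  have bound: "l a \<le> card V" if "a \<in> V" for a
    using l that by (auto simp: bij_betw_def)
  have "bij_betw r V {1..card V}"
    using l r_V by (subst bij_betw_cong[of V r l]) auto
  then have "bij_betw r (insert v V) (insert (r v) {1..card V})"
    using insert.hyps(2) by (simp add: r_def bij_betw_def)
  moreover have "insert (r v) {1..card V} = {1..card (insert v V)}"
    using fin insert.hyps(2) by (auto simp: r_def)
  moreover have "clique {a \<in> insert v V. r a < r m \<and> {m, a} \<in> E} E" if m: "m \<in> insert v V" for m
  proof (cases "m = v")
    case True
    then have "{a \<in> insert v V. r a < r m \<and> {m, a} \<in> E} \<subseteq> {a \<in> V. {v, a} \<in> E}" by auto
    with insert.hyps(3) show ?thesis unfolding clique_def by blast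
  next
    case False
    then have "m \<in> V" using m by simp
    \<comment> \<open>The new vertex \<open>v\<close> has a label above \<open>card V\<close>, so it
      is never a lower neighbour of an older \<open>m\<close>.\<close>
    then have "{a \<in> insert v V. r a < r m \<and> {m, a} \<in> E} \<subseteq> {a \<in> V. l a < l m \<and> {m, a} \<in> E}"
      using bound[of m] r_V by (auto simp: r_def split: if_splits)
    with elim[OF \<open>m \<in> V\<close>] show ?thesis unfolding clique_def by blast
  qed
  ultimately show ?case using fin by auto
qed

section \<open>Skeleton-clique-chordality and gluing\<close>

text \<open>Forwards, two edges with the same top vertex already force its lower neighbours to be
  adjacent. Backwards, two faces with equal maximum share their top vertex, and all their other
  vertices are lower neighbours of it, hence pairwise adjacent.\<close>

lemma skeleton_clique_chordal_iff_perfectly_eliminable: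
  assumes sc: "simplicial_complex \<Delta>"
  shows "skeleton_clique_chordal \<Delta> \<longleftrightarrow> perfectly_eliminable \<Delta> (vertices \<Delta>)"
proof
  assume "skeleton_clique_chordal \<Delta>"
  then obtain l where l: "vertex_labeling l \<Delta>"
    and C: "\<And>f g h. f \<in> \<Delta> \<Longrightarrow> g \<in> \<Delta> \<Longrightarrow> f \<noteq> g \<Longrightarrow> card f = card g \<Longrightarrow> card f \<ge> 2 \<Longrightarrow>
      Max (l ` f) = Max (l ` g) \<Longrightarrow> h \<subseteq> f \<union> g \<Longrightarrow> card h = 2 \<Longrightarrow> h \<in> \<Delta>"
    unfolding skeleton_clique_chordal_def by metis
  have "perfectly_eliminable \<Delta> S" if "finite S" "S \<subseteq> vertices \<Delta>" for S
    using that
  \<comment> \<open>Vertices are inserted by increasing label, so \<open>x\<close> has the largest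
    label so far. The rule allows \<open>x \<in> S\<close>, which is why that case is split
    off.\<close>
  proof (induction S rule: finite_ranking_induct[where f = l])
    case empty
    show ?case by (rule perfectly_eliminable.empty)
  next
    case (insert x S)
    show ?case
    proof (cases "x \<in> S")
      case True
      with insert show ?thesis by (simp add: insert_absorb)
    next
      case False
      have "clique {a \<in> S. {x, a} \<in> \<Delta>} \<Delta>"
        unfolding clique_def
      proof (intro ballI impI)
        fix a b assume a: "a \<in> {a \<in> S. {x, a} \<in> \<Delta>}" and b: "b \<in> {a \<in> S. {x, a} \<in> \<Delta>}"
          and ab: "a \<noteq> b"
        have "x \<noteq> a" "x \<noteq> b" using a b False by auto
        moreover have "{x, a} \<noteq> {x, b}" using ab by (auto simp: doubleton_eq_iff)
        moreover have "Max (l ` {x, a}) = l x" "Max (l ` {x, b}) = l x"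
          using a b insert.hyps(2) by (auto intro!: max_absorb1)
        ultimately show "{a, b} \<in> \<Delta>"
          using C[of "{x, a}" "{x, b}" "{a, b}"] a b ab by simp
      qed
      with False insert show ?thesis by (intro perfectly_eliminable.insert) auto
    qed
  qed
  then show "perfectly_eliminable \<Delta> (vertices \<Delta>)" using finite_vertices[OF sc] by simp
next
  assume "perfectly_eliminable \<Delta> (vertices \<Delta>)"
  then obtain l where l: "bij_betw l (vertices \<Delta>) {1..card (vertices \<Delta>)}"
    and elim: "\<And>m. m \<in> vertices \<Delta> \<Longrightarrow> clique {a \<in> vertices \<Delta>. l a < l m \<and> {m, a} \<in> \<Delta>} \<Delta>"
    using perfectly_eliminable_labeling by blast
  have inj: "inj_on l (vertices \<Delta>)" using l by (simp add: bij_betw_def)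
  have "h \<in> \<Delta>"
    if "f \<in> \<Delta>" "g \<in> \<Delta>" "card f = card g" "card f \<ge> 2" "Max (l ` f) = Max (l ` g)"
      "h \<subseteq> f \<union> g" "card h = 2" for f g h
  proof -
    have fin: "finite f" "finite g" using that finite_face[OF sc] by auto
    have V: "f \<subseteq> vertices \<Delta>" "g \<subseteq> vertices \<Delta>" using that face_subset_vertices by auto
    have ne: "f \<noteq> {}" "g \<noteq> {}" using that by auto
    have "Max (l ` f) \<in> l ` f" "Max (l ` g) \<in> l ` g" using fin ne by (intro Max_in; simp)+
    then obtain m m' where m: "m \<in> f" "Max (l ` f) = l m" and m': "m' \<in> g" "Max (l ` g) = l m'"
      by blast
    \<comment> \<open>Injectivity of the labeling turns equal maxima into a common top
      vertex.\<close>
    have "m' = m" using inj_onD[OF inj, of m' m] m m' V that by auto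
    with m' have m_g: "m \<in> g" by simp
    have edge: "{m, a} \<in> \<Delta>" if "a \<in> f \<union> g" for a
      using face_subset[OF sc, of f "{m, a}"] face_subset[OF sc, of g "{m, a}"]
        that m m_g \<open>f \<in> \<Delta>\<close> \<open>g \<in> \<Delta>\<close> by auto
    have less: "l a < l m" if "a \<in> f \<union> g" "a \<noteq> m" for a
    proof -
      have "l a \<le> l m"
        using that m fin \<open>Max (l ` f) = Max (l ` g)\<close> Max_ge[of "l ` f" "l a"] Max_ge[of "l ` g" "l a"]
        by auto
      moreover have "l a \<noteq> l m" using inj_onD[OF inj, of a m] that V m by auto
      ultimately show ?thesis by simp
    qed
    obtain a b where h: "h = {a, b}" "a \<noteq> b" using \<open>card h = 2\<close> by (meson card_2_iff)
    have ab: "a \<in> f \<union> g" "b \<in> f \<union> g" using h that by auto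
    show ?thesis
    proof (cases "a = m \<or> b = m")
      case True
      then show ?thesis using edge ab h by (auto simp: insert_commute)
    next
      case False
      have "m \<in> vertices \<Delta>" using m V by auto
      from elim[OF this] show ?thesis
        using edge[of a] edge[of b] less[of a] less[of b] ab V False h unfolding clique_def by auto
    qed
  qed
  then show "skeleton_clique_chordal \<Delta>"
    unfolding skeleton_clique_chordal_def vertex_labeling_def using l by blast
qed

lemma skeleton_clique_chordal_Un:
  assumes sc1: "simplicial_complex \<Delta>1" and sc2: "simplicial_complex \<Delta>2"
    and "skeleton_clique_chordal \<Delta>1" and "skeleton_clique_chordal \<Delta>2"
    and clique: "clique_skeleton (\<Delta>1 \<inter> \<Delta>2)"
  shows "skeleton_clique_chordal (\<Delta>1 \<union> \<Delta>2)"
proof -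
  let ?V1 = "vertices \<Delta>1" and ?V2 = "vertices \<Delta>2" and ?E = "\<Delta>1 \<union> \<Delta>2"
  have sc: "simplicial_complex ?E" using sc1 sc2 by (auto simp: simplicial_complex_def)
  have K: "clique (?V1 \<inter> ?V2) (\<Delta>1 \<inter> \<Delta>2)"
    using clique vertices_Int[OF sc1 sc2] by (simp add: clique_skeleton_iff)
  \<comment> \<open>The case \<open>u = v\<close> is included because comparing edge sets below
    ranges over all pairs, singletons among them.\<close>
  have common: "{u, v} \<in> \<Delta>1 \<inter> \<Delta>2" if "u \<in> ?V1 \<inter> ?V2" "v \<in> ?V1 \<inter> ?V2" for u v
  proof (cases "u = v")
    case True
    with that show ?thesis
      using vertex_iff_singleton_face[OF sc1] vertex_iff_singleton_face[OF sc2] by simp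
  next
    case False
    with that K show ?thesis unfolding clique_def by blast
  qed
  have ends: "u \<in> vertices \<Gamma> \<and> v \<in> vertices \<Gamma>" if "{u, v} \<in> \<Gamma>" for u v and \<Gamma> :: "'a set set"
    using face_subset_vertices[OF that] by simp
  have elim1: "perfectly_eliminable \<Delta>1 ?V1" and elim2: "perfectly_eliminable \<Delta>2 ?V2"
    using assms by (simp_all flip: skeleton_clique_chordal_iff_perfectly_eliminable)
  \<comment> \<open>An edge of \<open>\<Delta>2\<close> with both ends in \<open>?V1\<close> has
    both ends in the common clique, so it is an edge of \<open>\<Delta>1\<close> too. Thus each
    piece has the 1-skeleton that the union induces on its vertices.\<close>
  have edge1: "{u, v} \<in> \<Delta>1 \<longleftrightarrow> {u, v} \<in> ?E" if "u \<in> ?V1" "v \<in> ?V1" for u v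
    using common[of u v] ends[of u v \<Delta>2] that by blast
  have edge2: "{u, v} \<in> \<Delta>2 \<longleftrightarrow> {u, v} \<in> ?E" if "u \<in> ?V2" "v \<in> ?V2" for u v
    using common[of u v] ends[of u v \<Delta>1] that by blast
  have "perfectly_eliminable ?E (?V1 \<union> ?V2)"
  proof (rule perfectly_eliminable_glue[OF perfectly_eliminable_cong[OF elim1 edge1]
        perfectly_eliminable_cong[OF elim2 edge2] finite_vertices[OF sc2]])
    show "clique (?V1 \<inter> ?V2) ?E" using K unfolding clique_def by blast
    \<comment> \<open>As \<open>v\<close> is not a vertex of \<open>\<Delta>1\<close>, the edge must
      come from \<open>\<Delta>2\<close>.\<close>
    show "u \<in> ?V2" if "u \<in> ?V1" "v \<in> ?V2 - ?V1" "{v, u} \<in> ?E" for u v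
      using that ends[of v u] by blast
  qed
  moreover have "?V1 \<union> ?V2 = vertices ?E" by (simp add: vertices_def)
  ultimately show ?thesis
    using skeleton_clique_chordal_iff_perfectly_eliminable[OF sc] by simp
qed

section \<open>Combining the two statements\<close>

text \<open>Rules out \<open>{{}}\<close>, of dimension -1, for which both alternatives of (1) fail:
  it has no vertex and no proper subcomplex.\<close>

lemma vertices_nonempty:
  assumes "simplicial_complex \<Delta>" "dimension \<Delta> = int d"
  shows "vertices \<Delta> \<noteq> {}"
proof
  assume "vertices \<Delta> = {}"
  then have "\<Delta> = {{}}" using assms(1) by (auto simp: vertices_def simplicial_complex_def)
  with assms(2) show False by (simp add: dimension_def)
qed

theorem theorem116:
  fixes \<Delta> :: "'a set set" and d :: nat
  assumes "simplicial_complex \<Delta>" and "dimension \<Delta> = int d"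
  shows "(skeleton_E_chordal \<Delta> \<longrightarrow>
            (\<exists>v \<in> vertices \<Delta>. \<Delta> = neighborhood v \<Delta>) \<or>
            (\<exists>\<Delta>1 \<Delta>2. \<Delta> = \<Delta>1 \<union> \<Delta>2 \<and>
               proper_subcomplex \<Delta>1 \<Delta> \<and> skeleton_E_chordal \<Delta>1 \<and>
               proper_subcomplex \<Delta>2 \<Delta> \<and> skeleton_E_chordal \<Delta>2 \<and>
               simplicial_complex (\<Delta>1 \<inter> \<Delta>2) \<and> clique_skeleton (\<Delta>1 \<inter> \<Delta>2))) \<and>
         (\<forall>\<Delta>1 \<Delta>2. \<Delta> = \<Delta>1 \<union> \<Delta>2 \<and>
            proper_subcomplex \<Delta>1 \<Delta> \<and> skeleton_clique_chordal \<Delta>1 \<and>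
            proper_subcomplex \<Delta>2 \<Delta> \<and> skeleton_clique_chordal \<Delta>2 \<and>
            simplicial_complex (\<Delta>1 \<inter> \<Delta>2) \<and> clique_skeleton (\<Delta>1 \<inter> \<Delta>2) \<longrightarrow>
            skeleton_clique_chordal \<Delta>)"
  using skeleton_E_chordal_splits[OF assms(1) _ vertices_nonempty[OF assms]]
  by (auto simp: proper_subcomplex_def intro: skeleton_clique_chordal_Un)

end
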